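(* Let $K$ be a (not necessarily commutative) field admitting an involution $\sigma$, let $n\geq 2$, let $R=K^{n\times n}$, and let $H_\sigma\subset R$ be the Jordan system of all $\sigma$-Hermitian matrices of $R$. Then the point set of the projective space of $\sigma$-Hermitian $n\times n$ matrices over $K$ (the set of all maximal totally isotropic subspaces of $(K^{2n},\beta)$) coincides with the projective line $\mathbb{P}(H_\sigma)$ over $H_\sigma$, where each point $R(A,B)$ of $\mathbb{P}(H_\sigma)$ is identified with the left row space of $(A,B)$. That is, $$\{U\subseteq K^{2n}\mid U \text{ is a maximal totally isotropic subspace with respect to } \beta\}=\{\text{left row space of }(T_2T_1-I,\,T_2)\mid T_1,T_2\in H_\sigma\}.$$
   Context: Here "field" means a not necessarily commutative field (division ring). An involution of $K$ is an antiautomorphism $\sigma$ of $K$ (an additive bijection with $(ab)^\sigma=b^\sigma a^\sigma$) such that $\sigma^2=\mathrm{id}_K$; the case $\sigma=\mathrm{id}_K$ (with $K$ then commutative) is allowed, and there is no restriction on the characteristic. $R=K^{n\times n}$ is the ring of $n\times n$ matrices over $K$, and $I$ is the identity matrix. For $M=(m_{ij})\in R$ put $M^\Sigma:=(m_{ji}^\sigma)$. The set of $\sigma$-Hermitian matrices is $H_\sigma:=\{X\in R\mid X=X^\Sigma\}$. $K^{2n}$ is the left vector space of row vectors of length $2n$ over $K$. For $A,B\in R$, $(A,B)$ denotes the $n\times 2n$ matrix obtained by horizontal augmentation; its left row space is the left $K$-subspace of $K^{2n}$ spanned by its rows. $R(A,B)=\{(XA,XB)\mid X\in R\}$ is the cyclic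 left $R$-submodule of $R^2$ generated by $(A,B)$. The projective line over $R$ is $\mathbb{P}(R)=\{R(A,B)\mid A,B\in R,\ (A,B)\text{ has left row rank } n\}$. Each point $R(A,B)$ of $\mathbb{P}(R)$ is identified with the $n$-dimensional subspace of $K^{2n}$ which is the left row space of $(A,B)$ (this is a well-defined bijection between $\mathbb{P}(R)$ and the set of $n$-dimensional subspaces of $K^{2n}$). The projective line over $H_\sigma$ is the subset $\mathbb{P}(H_\sigma):=\{R(T_2T_1-I,\,T_2)\mid T_1,T_2\in H_\sigma\}$ of $\mathbb{P}(R)$. $\beta:K^{2n}\times K^{2n}\to K$ is the non-degenerate $\sigma$-anti-Hermitian sesquilinear form whose matrix with respect to the standard basis is $\begin{pmatrix}0&I_n\\-I_n&0\end{pmatrix}$, i.e. $(x,y)^\beta=\sum_{i=1}^n\left(x_i y_{n+i}^\sigma-x_{n+i}y_i^\sigma\right)$. A subspace $U$ of $K^{2n}$ is totally isotropic if $(x,y)^\beta=0$ for all $x,y\in U$; it is maximal totally isotropic if it is maximal with respect to inclusion among totally isotropic subspaces. All maximal totally isotropic subspaces have dimension $n$. The point set of the projective space of $\sigma$-Hermitian $n\times n$ matrices over $K$ is, by definition, the set of all maximal totally isotropic subspaces of $(K^{2n},\beta)$. *)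

theory Defs
  imports "HOL-Analysis.Analysis"
begin

text \<open>
  Throughout, \<open>'a :: division_ring\<close> is a not necessarily commutative field \<open>K\<close>,
  \<open>n\<close> is \<open>CARD('n)\<close>, the ring \<open>R\<close> is \<open>'a^'n^'n\<close> (with product \<open>**\<close> and identity \<open>mat 1\<close>),
  and the left vector space of row vectors of length \<open>2n\<close> is \<open>'a^('n + 'n)\<close>, where \<open>Inl i\<close> is the
  \<open>i\<close>-th coordinate of the first half and \<open>Inr i\<close> that of the second half. The scalar
  multiplication \<open>*s\<close> acts from the left. The library's vector spaces and matrix rank require a
  commutative field of scalars, so left subspaces, row spaces and row rank are defined here.
\<close>

definition involution :: "('a::division_ring \<Rightarrow> 'a) \<Rightarrow> bool" where
  "involution \<sigma> \<longleftrightarrow> bij \<sigma> \<and> (\<forall>a b. \<sigma> (a + b) = \<sigma> a + \<sigma> b) \<and>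
     (\<forall>a b. \<sigma> (a * b) = \<sigma> b * \<sigma> a) \<and> (\<forall>a. \<sigma> (\<sigma> a) = a)"

definition conj_transpose :: "('a \<Rightarrow> 'a) \<Rightarrow> 'a^'n^'n \<Rightarrow> 'a^'n^'n" where
  "conj_transpose \<sigma> M = (\<chi> i j. \<sigma> (M $ j $ i))"

definition hermitian_matrices :: "('a \<Rightarrow> 'a) \<Rightarrow> ('a^'n^'n) set" where
  "hermitian_matrices \<sigma> = {X. X = conj_transpose \<sigma> X}"

definition left_subspace :: "('a::division_ring^'m) set \<Rightarrow> bool" where
  "left_subspace U \<longleftrightarrow> 0 \<in> U \<and> (\<forall>x\<in>U. \<forall>y\<in>U. x + y \<in> U) \<and> (\<forall>c. \<forall>x\<in>U. c *s x \<in> U)"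

definition left_row_space :: "'a::division_ring^'m^'k \<Rightarrow> ('a^'m) set" where
  "left_row_space M = left_subspace hull rows M"

definition left_independent_rows :: "'a::division_ring^'m^'k \<Rightarrow> 'k set \<Rightarrow> bool" where
  "left_independent_rows M J \<longleftrightarrow>
     (\<forall>c. (\<Sum>j\<in>J. c j *s row j M) = 0 \<longrightarrow> (\<forall>j\<in>J. c j = 0))"

text \<open>The left row rank is the maximal number of left linearly independent rows.\<close>

definition left_row_rank :: "'a::division_ring^'m^'k \<Rightarrow> nat" where
  "left_row_rank M = Max {card J | J. left_independent_rows M J}"

definition augment :: "'a^'n^'n \<Rightarrow> 'a^'n^'n \<Rightarrow> 'a^('n + 'n)^'n" where
  "augment A B = (\<chi> i j. case j of Inl k \<Rightarrow> A $ i $ k | Inr k \<Rightarrow> B $ i $ k)"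

text \<open>The cyclic left submodule \<open>R(A,B)\<close> of \<open>R\<^sup>2\<close>.\<close>

definition cyclic_submodule ::
    "'a::division_ring^'n^'n \<Rightarrow> 'a^'n^'n \<Rightarrow> (('a^'n^'n) \<times> ('a^'n^'n)) set" where
  "cyclic_submodule A B = {(X ** A, X ** B) | X. True}"

definition proj_line :: "(('a::division_ring^'n^'n) \<times> ('a^'n^'n)) set set" where
  "proj_line = {cyclic_submodule A B | A B. left_row_rank (augment A B) = CARD('n)}"

definition proj_line_hermitian ::
    "('a::division_ring \<Rightarrow> 'a) \<Rightarrow> (('a^'n^'n) \<times> ('a^'n^'n)) set set" where
  "proj_line_hermitian \<sigma> = {cyclic_submodule (T\<^sub>2 ** T\<^sub>1 - mat 1) T\<^sub>2 | T\<^sub>1 T\<^sub>2.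
     T\<^sub>1 \<in> hermitian_matrices \<sigma> \<and> T\<^sub>2 \<in> hermitian_matrices \<sigma>}"

text \<open>
  The subspace with which a point of \<^const>\<open>proj_line\<close> is identified. That it does not depend on
  the representative, that distinct points yield distinct subspaces, and that
  \<^const>\<open>proj_line_hermitian\<close> consists of points of \<^const>\<open>proj_line\<close> is shown below.
\<close>

definition point_subspace ::
    "(('a::division_ring^'n^'n) \<times> ('a^'n^'n)) set \<Rightarrow> ('a^('n::finite + 'n)) set" where
  "point_subspace p = (THE U. \<exists>A B. left_row_rank (augment A B) = CARD('n) \<and>
     p = cyclic_submodule A B \<and> U = left_row_space (augment A B))"

definition beta_form ::
    "('a::division_ring \<Rightarrow> 'a) \<Rightarrow> 'a^('n::finite + 'n) \<Rightarrow> 'a^('n + 'n) \<Rightarrow> 'a" where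
  "beta_form \<sigma> x y = (\<Sum>i\<in>UNIV. x $ Inl i * \<sigma> (y $ Inr i) - x $ Inr i * \<sigma> (y $ Inl i))"

definition totally_isotropic ::
    "('a::division_ring \<Rightarrow> 'a) \<Rightarrow> ('a^('n::finite + 'n)) set \<Rightarrow> bool" where
  "totally_isotropic \<sigma> U \<longleftrightarrow> left_subspace U \<and> (\<forall>x\<in>U. \<forall>y\<in>U. beta_form \<sigma> x y = 0)"

definition maximal_totally_isotropic ::
    "('a::division_ring \<Rightarrow> 'a) \<Rightarrow> ('a^('n::finite + 'n)) set \<Rightarrow> bool" where
  "maximal_totally_isotropic \<sigma> U \<longleftrightarrow> totally_isotropic \<sigma> U \<and>
     (\<forall>V. totally_isotropic \<sigma> V \<and> U \<subseteq> V \<longrightarrow> V = U)"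

definition proj_space_points :: "('a::division_ring \<Rightarrow> 'a) \<Rightarrow> ('a^('n::finite + 'n)) set set" where
  "proj_space_points \<sigma> = {U. maximal_totally_isotropic \<sigma> U}"

lemma vector_matrix_mult_eq_sum_rows:
  fixes M :: "'a::division_ring^'m^'k"
  shows "x v* M = (\<Sum>i\<in>UNIV. x $ i *s row i M)"
  by (simp add: vec_eq_iff vector_matrix_mult_def row_def)

lemma left_subspace_range: "left_subspace (range (\<lambda>x. x v* (M :: 'a::division_ring^'m^'k)))"
proof -
  have "0 \<in> range (\<lambda>x. x v* M)"
    by (rule image_eqI[where x = 0]) auto
  moreover have "x v* M + y v* M \<in> range (\<lambda>x. x v* M)" for x y
    by (rule image_eqI[where x = "x + y"]) (auto simp: vector_matrix_left_distrib)
  moreover have "c *s (x v* M) \<in> range (\<lambda>x. x v* M)" for c x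
    by (rule image_eqI[where x = "c *s x"])
      (auto simp: vec_eq_iff vector_matrix_mult_def sum_distrib_left mult.assoc)
  ultimately show ?thesis by (auto simp: left_subspace_def)
qed

lemma left_row_space_eq_range:
  fixes M :: "'a::division_ring^'m^'k"
  shows "left_row_space M = range (\<lambda>x. x v* M)"
  unfolding left_row_space_def
proof (rule hull_unique)
  show "rows M \<subseteq> range (\<lambda>x. x v* M)"
  proof
    fix r assume "r \<in> rows M"
    then obtain i where "r = row i M" by (auto simp: rows_def)
    also have "\<dots> = axis i 1 v* M"
      by (simp add: vec_eq_iff vector_matrix_mult_def axis_def row_def if_distrib
          if_distribR cong: if_cong)
    finally show "r \<in> range (\<lambda>x. x v* M)" by blast
  qed
  show "left_subspace (range (\<lambda>x. x v* M))" by (rule left_subspace_range)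
  fix U assume U: "rows M \<subseteq> U" "left_subspace U"
  have "(\<Sum>i\<in>F. x $ i *s row i M) \<in> U" if "finite F" for F x
    using that by (induction F rule: finite_induct)
      (use U in \<open>auto simp: left_subspace_def rows_def\<close>)
  then show "range (\<lambda>x. x v* M) \<subseteq> U"
    by (auto simp: vector_matrix_mult_eq_sum_rows)
qed

lemma left_row_space_eqD:
  fixes M N :: "'a::division_ring^'m^'k"
  assumes "left_row_space M \<subseteq> left_row_space N"
  shows "\<exists>X. M = X ** N"
proof -
  have "\<exists>x. row i M = x v* N" for i
  proof -
    have "row i M \<in> left_row_space M"
      unfolding left_row_space_def by (rule hull_inc) (auto simp: rows_def)
    then show ?thesis using assms by (auto simp: left_row_space_eq_range)
  qed
  then obtain f where f: "\<And>i. row i M = f i v* N" by metis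
  have "M = (\<chi> i. f i) ** N"
    using f by (simp add: vec_eq_iff row_def matrix_matrix_mult_def vector_matrix_mult_def)
  then show ?thesis by blast
qed

lemma matrix_mult_augment: "X ** augment A B = augment (X ** A) (X ** B)"
  by (auto simp: vec_eq_iff augment_def matrix_matrix_mult_def split: sum.splits)

lemma augment_inject: "augment A B = augment C D \<longleftrightarrow> A = C \<and> B = D"
proof
  assume "augment A B = augment C D"
  then have *: "augment A B $ i $ j = augment C D $ i $ j" for i j by simp
  show "A = C \<and> B = D"
    using *[of _ "Inl _"] *[of _ "Inr _"] by (simp add: vec_eq_iff augment_def)
qed auto

lemma left_row_space_mult_subset:
  "left_row_space (X ** N) \<subseteq> left_row_space (N :: 'a::division_ring^'m^'k)"
  by (auto simp: left_row_space_eq_range vector_matrix_mul_assoc[symmetric])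

lemma cyclic_submodule_subset_iff:
  "cyclic_submodule A B \<subseteq> cyclic_submodule C D \<longleftrightarrow>
     left_row_space (augment A B) \<subseteq> left_row_space (augment C D)"
proof
  assume "cyclic_submodule A B \<subseteq> cyclic_submodule C D"
  moreover have "(A, B) \<in> cyclic_submodule A B"
    unfolding cyclic_submodule_def by (auto intro: exI[of _ "mat 1"])
  ultimately have "(A, B) \<in> cyclic_submodule C D" by blast
  then obtain X where "A = X ** C" "B = X ** D"
    unfolding cyclic_submodule_def by blast
  then show "left_row_space (augment A B) \<subseteq> left_row_space (augment C D)"
    using left_row_space_mult_subset[of X "augment C D"] by (simp add: matrix_mult_augment)
next
  assume "left_row_space (augment A B) \<subseteq> left_row_space (augment C D)"
  then obtain X where "augment A B = X ** augment C D"
    using left_row_space_eqD by blast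
  then have X: "A = X ** C" "B = X ** D"
    by (auto simp: matrix_mult_augment augment_inject)
  then show "cyclic_submodule A B \<subseteq> cyclic_submodule C D"
    by (auto simp: cyclic_submodule_def matrix_mul_assoc)
qed

lemma cyclic_submodule_eq_iff:
  "cyclic_submodule A B = cyclic_submodule C D \<longleftrightarrow>
     left_row_space (augment A B) = left_row_space (augment C D)"
  by (simp add: set_eq_subset cyclic_submodule_subset_iff)

lemma point_subspace_cyclic_submodule:
  fixes A B :: "'a::division_ring^'n^'n"
  assumes "left_row_rank (augment A B) = CARD('n)"
  shows "point_subspace (cyclic_submodule A B) = left_row_space (augment A B)"
  unfolding point_subspace_def
  by (rule the_equality) (use assms in \<open>auto simp: cyclic_submodule_eq_iff\<close>)

lemma inj_on_point_subspace: "inj_on point_subspace proj_line"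
  by (smt (verit, best) inj_onI proj_line_def mem_Collect_eq point_subspace_cyclic_submodule
      cyclic_submodule_eq_iff)

lemma left_row_rank_eq_card:
  fixes M :: "'a::division_ring^'m^'k"
  assumes "\<And>x. x v* M = 0 \<Longrightarrow> x = 0"
  shows "left_row_rank M = CARD('k)"
  unfolding left_row_rank_def
proof (rule Max_eqI)
  have "{card J | J. left_independent_rows M J} \<subseteq> {..CARD('k)}"
    by (auto intro: card_mono)
  then show "finite {card J | J. left_independent_rows M J}"
    by (rule finite_subset) simp
  show "k \<le> CARD('k)" if "k \<in> {card J | J. left_independent_rows M J}" for k
    using that by (auto intro: card_mono)
  have "left_independent_rows M UNIV"
    unfolding left_independent_rows_def
  proof (intro allI impI ballI)
    fix c :: "'k \<Rightarrow> 'a" and j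
    assume "(\<Sum>j\<in>UNIV. c j *s row j M) = 0"
    then have "(\<chi> j. c j) v* M = 0" by (simp add: vector_matrix_mult_eq_sum_rows)
    then have "(\<chi> j. c j) = 0" by (rule assms)
    then show "c j = 0" by (simp add: vec_eq_iff)
  qed
  then show "CARD('k) \<in> {card J | J. left_independent_rows M J}" by blast
qed

lemma vector_mult_augment_eq_0_iff:
  "x v* augment A B = 0 \<longleftrightarrow> x v* A = 0 \<and> x v* (B :: 'a::division_ring^'n^'n) = 0"
proof
  assume "x v* augment A B = 0"
  then have *: "(x v* augment A B) $ j = 0" for j by simp
  show "x v* A = 0 \<and> x v* B = 0"
    using *[of "Inl _"] *[of "Inr _"]
    by (simp add: vec_eq_iff augment_def vector_matrix_mult_def)
next
  assume "x v* A = 0 \<and> x v* B = 0"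
  then show "x v* augment A B = 0"
    unfolding vec_eq_iff by (intro allI, case_tac i)
      (auto simp: augment_def vector_matrix_mult_def)
qed

lemma left_row_rank_hermitian_point:
  fixes T\<^sub>1 T\<^sub>2 :: "'a::division_ring^'n^'n"
  shows "left_row_rank (augment (T\<^sub>2 ** T\<^sub>1 - mat 1) T\<^sub>2) = CARD('n)"
proof (rule left_row_rank_eq_card)
  fix x :: "'a^'n"
  assume "x v* augment (T\<^sub>2 ** T\<^sub>1 - mat 1) T\<^sub>2 = 0"
  then have "x v* (T\<^sub>2 ** T\<^sub>1 - mat 1) = 0" "x v* T\<^sub>2 = 0"
    by (auto simp: vector_mult_augment_eq_0_iff)
  moreover have "x v* (T\<^sub>2 ** T\<^sub>1 - mat 1) = (x v* T\<^sub>2) v* T\<^sub>1 - x"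
    by (simp add: vector_matrix_mult_diff_rdistrib vector_matrix_mul_assoc)
  ultimately show "x = 0" by simp
qed

lemma proj_line_hermitian_subset: "proj_line_hermitian \<sigma> \<subseteq> proj_line"
  using left_row_rank_hermitian_point by (force simp: proj_line_hermitian_def proj_line_def)

end

theory Submission
  imports Defs
begin

text \<open>
  Write vectors of \<open>K\<^bsup>2n\<^esup>\<close> as pairs \<open>(x, y)\<close> of vectors of length \<open>n\<close>. The form is then
  \<open>\<langle>x, y'\<rangle> - \<langle>y, x'\<rangle>\<close> with \<open>\<langle>x, y\<rangle> = \<Sum>i. x\<^sub>i \<sigma>(y\<^sub>i)\<close>, and a matrix \<open>M\<close> is Hermitian iff it is
  self-adjoint for \<open>\<langle>_, _\<rangle>\<close>. Two facts follow directly: the graph \<open>{(x, xM)}\<close> of a Hermitian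
  matrix is maximal totally isotropic, and the shear \<open>(x, y) \<mapsto> (x + yT, y)\<close> by a Hermitian \<open>T\<close> is
  an isometry. The row space of \<open>(T\<^sub>2T\<^sub>1 - I, T\<^sub>2)\<close> is the image under the shear by \<open>T\<^sub>1\<close> of the
  graph of \<open>-T\<^sub>2\<close>. So the claim is that every maximal totally isotropic \<open>U\<close> is a sheared graph
  (\<open>maximal_totally_isotropic_iff\<close>), and this has two parts.

  A maximal totally isotropic subspace that meets \<open>0 \<times> K\<^sup>n\<close> only in \<open>0\<close> is a graph
  (\<open>maximal_totally_isotropic_eq_graph\<close>): it is the graph of a linear map on its projection \<open>P\<close> to
  the first component, and if \<open>P\<close> were proper, some \<open>z \<noteq> 0\<close> would annihilate it, so that \<open>(0, z)\<close>
  could be adjoined to the subspace.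

  It remains to shear \<open>U\<close> away from \<open>0 \<times> K\<^sup>n\<close>, which means finding a Hermitian \<open>T\<close> such that \<open>U\<close>
  contains no \<open>(yT, y)\<close> with \<open>y \<noteq> 0\<close> (\<open>exists_transversal_hermitian\<close>). A diagonal matrix with
  entries \<open>0\<close> and \<open>1\<close> suffices in every characteristic: let \<open>P = {y. (0, y) \<in> U}\<close>, choose a
  coordinate subspace \<open>E\<close> with \<open>K\<^sup>n = P \<oplus> E\<close>, and let \<open>T\<close> annihilate \<open>E\<close> and fix the remaining
  coordinates. If \<open>v = (yT, y) \<in> U\<close>, then \<open>v\<close> is orthogonal to \<open>0 \<times> P\<close> because \<open>U\<close> is isotropic,
  and to \<open>0 \<times> E\<close> by the choice of \<open>T\<close>; hence \<open>yT = 0\<close>, so \<open>y \<in> P \<inter> E = 0\<close>.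
\<close>

section \<open>Left linear algebra over a division ring\<close>

definition coordinate_subspace :: "'m set \<Rightarrow> ('a::division_ring^'m) set" where
  "coordinate_subspace J = {x. \<forall>i. i \<notin> J \<longrightarrow> x $ i = 0}"

lemma left_subspace_0: "left_subspace U \<Longrightarrow> 0 \<in> U"
  and left_subspace_add: "left_subspace U \<Longrightarrow> x \<in> U \<Longrightarrow> y \<in> U \<Longrightarrow> x + y \<in> U"
  and left_subspace_scale: "left_subspace U \<Longrightarrow> x \<in> U \<Longrightarrow> c *s x \<in> U"
  by (auto simp: left_subspace_def)

lemma left_subspace_uminus: "left_subspace U \<Longrightarrow> x \<in> U \<Longrightarrow> - x \<in> U"
  using left_subspace_scale[of U x "- 1"] by (simp add: vector_sneg_minus1)

lemma left_subspace_diff: "left_subspace U \<Longrightarrow> x \<in> U \<Longrightarrow> y \<in> U \<Longrightarrow> x - y \<in> U"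
  using left_subspace_add[of U x "- y"] left_subspace_uminus[of U y] by simp

lemma left_subspace_sum:
  "left_subspace U \<Longrightarrow> (\<And>i. i \<in> F \<Longrightarrow> f i \<in> U) \<Longrightarrow> sum f F \<in> U"
  by (induction F rule: infinite_finite_induct) (auto simp: left_subspace_def)

lemma left_subspace_coordinate_subspace: "left_subspace (coordinate_subspace J)"
  by (auto simp: left_subspace_def coordinate_subspace_def)

text \<open>
  Steinitz exchange in the form in which it is needed, with no notion of dimension: if \<open>J\<close> is
  maximal such that the coordinate subspace of \<open>J\<close> meets \<open>P\<close> trivially, then enlarging \<open>J\<close> by
  \<open>i\<close> produces a vector of \<open>P\<close> that can be solved for the \<open>i\<close>-th unit vector.
\<close>

lemma coordinate_complement:
  fixes P :: "('a::division_ring^'m) set"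
  assumes P: "left_subspace P"
  obtains J where "P \<inter> coordinate_subspace J = {0}"
    and "\<And>x. \<exists>y \<in> coordinate_subspace J. x - y \<in> P"
proof -
  let ?E = "coordinate_subspace :: 'm set \<Rightarrow> ('a^'m) set"
  let ?F = "{J. P \<inter> ?E J = {0}}"
  have "{} \<in> ?F"
    using left_subspace_0[OF P] by (auto simp: coordinate_subspace_def vec_eq_iff)
  moreover have "finite ?F" by simp
  ultimately obtain J where J: "J \<in> ?F" and max: "\<And>J'. J' \<in> ?F \<Longrightarrow> J \<subseteq> J' \<Longrightarrow> J' = J"
    by (metis (no_types, lifting) finite_has_maximal2)
  have axis: "\<exists>y \<in> ?E J. axis i 1 - y \<in> P" for i
  proof (cases "i \<in> J")
    case True
    then have "axis i 1 \<in> ?E J" by (auto simp: coordinate_subspace_def axis_def)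
    then show ?thesis using left_subspace_0[OF P] by (intro bexI[of _ "axis i 1"]) auto
  next
    case False
    then have "insert i J \<notin> ?F" using max[of "insert i J"] by auto
    moreover have "0 \<in> P \<inter> ?E (insert i J)"
      using P left_subspace_coordinate_subspace by (auto intro: left_subspace_0)
    ultimately obtain p where p: "p \<in> P" "p \<in> ?E (insert i J)" "p \<noteq> 0" by blast
    have "p $ i \<noteq> 0"
    proof
      assume "p $ i = 0"
      then have "p \<in> ?E J" using p(2) by (auto simp: coordinate_subspace_def)
      then show False using J p by auto
    qed
    \<comment> \<open>\<open>p\<close> normalized to have \<open>i\<close>-th coordinate \<open>1\<close>; the scalar acts from the left, as \<open>P\<close> is a
        left subspace.\<close>
    let ?q = "inverse (p $ i) *s p"
    have "axis i 1 - (axis i 1 - ?q) \<in> P" using left_subspace_scale[OF P p(1)] by simp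
    moreover have "axis i 1 - ?q \<in> ?E J"
      using p(2) \<open>p $ i \<noteq> 0\<close> by (auto simp: coordinate_subspace_def axis_def)
    ultimately show ?thesis by blast
  qed
  then obtain b where b: "\<And>i. b i \<in> ?E J" "\<And>i. axis i 1 - b i \<in> P" by metis
  have "\<exists>y \<in> ?E J. x - y \<in> P" for x
  proof
    show "(\<Sum>i\<in>UNIV. x $ i *s b i) \<in> ?E J"
      by (intro left_subspace_sum left_subspace_scale left_subspace_coordinate_subspace b)
    have "x - (\<Sum>i\<in>UNIV. x $ i *s b i) = (\<Sum>i\<in>UNIV. x $ i *s (axis i 1 - b i))"
      by (simp add: sum_subtractf basis_expansion)
    also have "\<dots> \<in> P"
      by (intro left_subspace_sum left_subspace_scale P b)
    finally show "x - (\<Sum>i\<in>UNIV. x $ i *s b i) \<in> P" .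
  qed
  then show ?thesis using that J by blast
qed

lemma left_linear_eq_matrix:
  fixes f :: "'a::division_ring^'m \<Rightarrow> 'a^'k"
  assumes add: "\<And>x y. f (x + y) = f x + f y" and scale: "\<And>c x. f (c *s x) = c *s f x"
  obtains M where "\<And>x. f x = x v* M"
proof
  fix x
  have f0: "f 0 = 0" using scale[of 0 0] by simp
  have sum: "f (sum g F) = (\<Sum>i\<in>F. f (g i))" for g :: "'m \<Rightarrow> 'a^'m" and F
    by (induction F rule: infinite_finite_induct) (auto simp: add f0)
  have "f x = (\<Sum>i\<in>UNIV. x $ i *s f (axis i 1))"
    by (subst basis_expansion[symmetric]) (simp add: sum scale)
  also have "\<dots> = x v* (\<chi> i. f (axis i 1))"
    by (simp add: vector_matrix_mult_eq_sum_rows row_def)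
  finally show "f x = x v* (\<chi> i. f (axis i 1))" .
qed

section \<open>Vectors of length 2n as pairs, graphs and shears\<close>

definition sigma_dot :: "('a::division_ring \<Rightarrow> 'a) \<Rightarrow> 'a^'n \<Rightarrow> 'a^'n \<Rightarrow> 'a" where
  "sigma_dot \<sigma> x y = (\<Sum>i\<in>UNIV. x $ i * \<sigma> (y $ i))"

definition join :: "'a^'n \<Rightarrow> 'a^'n \<Rightarrow> 'a^('n::finite + 'n)" where
  "join x y = (\<chi> i. case i of Inl k \<Rightarrow> x $ k | Inr k \<Rightarrow> y $ k)"

lemma vec_sum_eq_iff: "u = v \<longleftrightarrow> (\<forall>i. u $ Inl i = v $ Inl i) \<and> (\<forall>i. u $ Inr i = v $ Inr i)"
  by (metis obj_sumE vec_eq_iff)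

lemma join_nth [simp]: "join x y $ Inl i = x $ i" "join x y $ Inr i = y $ i"
  by (simp_all add: join_def)

lemma join_cases: obtains x y where "u = join x y"
  by (rule that[of "\<chi> i. u $ Inl i" "\<chi> i. u $ Inr i"]) (simp add: vec_sum_eq_iff)

lemma join_eq_iff [simp]: "join x y = join x' y' \<longleftrightarrow> x = x' \<and> y = y'"
  by (auto simp: vec_sum_eq_iff vec_eq_iff)

lemma join_add: "join x y + join x' y' = join (x + x') (y + y')"
  and join_diff: "join a b - join a' b' = join (a - a') (b - b')"
  and join_scale: "c *s join p q = join (c *s p) (c *s q)"
  and join_0: "join 0 0 = 0"
  by (simp_all add: vec_sum_eq_iff)

lemma vector_mult_augment: "x v* augment A B = join (x v* A) (x v* B)"
  by (simp add: vec_sum_eq_iff augment_def vector_matrix_mult_def)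

lemma beta_form_join:
  "beta_form \<sigma> (join x y) (join x' y') = sigma_dot \<sigma> x y' - sigma_dot \<sigma> y x'"
  by (simp add: beta_form_def sigma_dot_def sum_subtractf)

lemma totally_isotropicD:
  assumes "totally_isotropic \<sigma> U"
  shows "left_subspace U" and "x \<in> U \<Longrightarrow> y \<in> U \<Longrightarrow> beta_form \<sigma> x y = 0"
  using assms by (auto simp: totally_isotropic_def)

definition graph :: "'a::division_ring^'n^'n \<Rightarrow> ('a^('n::finite + 'n)) set" where
  "graph M = range (\<lambda>x. join x (x v* M))"

definition shear :: "'a::division_ring^'n^'n \<Rightarrow> 'a^('n + 'n) \<Rightarrow> 'a^('n::finite + 'n)" where
  "shear T u = (let x = (\<chi> i. u $ Inl i); y = (\<chi> i. u $ Inr i) in join (x + y v* T) y)"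

lemma shear_join [simp]: "shear T (join x y) = join (x + y v* T) y"
  by (simp add: shear_def Let_def vec_sum_eq_iff vector_matrix_mult_def)

lemma vector_mult_uminus: "y v* (- T) = - (y v* (T :: 'a::division_ring^'k^'m))"
  by (simp add: vec_eq_iff vector_matrix_mult_def sum_negf)

lemma vector_uminus_mult: "(- y) v* T = - (y v* (T :: 'a::division_ring^'k^'m))"
  by (simp add: vec_eq_iff vector_matrix_mult_def sum_negf)

lemma vector_scale_mult: "(c *s y) v* T = c *s (y v* (T :: 'a::division_ring^'k^'m))"
  by (simp add: vec_eq_iff vector_matrix_mult_def sum_distrib_left mult.assoc)

lemma shear_shear_uminus [simp]: "shear T (shear (- T) u) = u" "shear (- T) (shear T u) = u"
  by (cases u rule: join_cases; simp add: vector_mult_uminus)+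

lemma shear_image_shear_uminus [simp]: "shear T ` shear (- T) ` U = U" "shear (- T) ` shear T ` U = U"
  by (simp_all add: image_image)

lemma shear_add: "shear T (u + v) = shear T u + shear T v"
  by (cases u rule: join_cases; cases v rule: join_cases)
    (simp add: join_add vector_matrix_left_distrib algebra_simps)

lemma shear_scale: "shear T (c *s u) = c *s shear T u"
  by (cases u rule: join_cases) (simp add: join_scale vector_scale_mult vector_add_ldistrib)

lemma left_subspace_shear:
  assumes "left_subspace U"
  shows "left_subspace (shear T ` U)"
proof -
  have "shear T 0 = 0" using shear_scale[of T 0 0] by simp
  then show ?thesis using assms
    unfolding left_subspace_def
    by (auto simp flip: shear_add shear_scale intro: rev_image_eqI)
qed

section \<open>Hermitian matrices and the form\<close>

locale division_ring_involution =
  fixes \<sigma> :: "'a::division_ring \<Rightarrow> 'a"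
  assumes inv: "involution \<sigma>"
begin

lemma sigma_add: "\<sigma> (a + b) = \<sigma> a + \<sigma> b"
  and sigma_mult: "\<sigma> (a * b) = \<sigma> b * \<sigma> a"
  and sigma_sigma [simp]: "\<sigma> (\<sigma> a) = a"
  using inv by (auto simp: involution_def)

lemma sigma_0 [simp]: "\<sigma> 0 = 0"
  using sigma_add[of 0 0] by simp

lemma sigma_1 [simp]: "\<sigma> 1 = 1"
  using sigma_mult[of "\<sigma> 1" 1] by simp

lemma sigma_uminus: "\<sigma> (- a) = - \<sigma> a"
  using sigma_add[of a "- a"] by (simp add: eq_neg_iff_add_eq_0 add.commute)

lemma sigma_diff: "\<sigma> (a - b) = \<sigma> a - \<sigma> b"
  using sigma_add[of a "- b"] by (simp add: sigma_uminus)

lemma sigma_eq_0_iff [simp]: "\<sigma> a = 0 \<longleftrightarrow> a = 0"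
  by (metis sigma_0 sigma_sigma)

lemma sigma_sum: "\<sigma> (sum f A) = (\<Sum>i\<in>A. \<sigma> (f i))"
  by (induction A rule: infinite_finite_induct) (auto simp: sigma_add)

lemma sigma_dot_add_left: "sigma_dot \<sigma> (x + x') y = sigma_dot \<sigma> x y + sigma_dot \<sigma> x' y"
  by (simp add: sigma_dot_def distrib_right sum.distrib)

lemma sigma_dot_add_right: "sigma_dot \<sigma> x (y + y') = sigma_dot \<sigma> x y + sigma_dot \<sigma> x y'"
  by (simp add: sigma_dot_def distrib_left sum.distrib sigma_add)

lemma sigma_dot_uminus:
  "sigma_dot \<sigma> (- x) y = - sigma_dot \<sigma> x y" "sigma_dot \<sigma> x (- y) = - sigma_dot \<sigma> x y"
  by (simp_all add: sigma_dot_def sigma_uminus sum_negf)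

lemma sigma_dot_0 [simp]: "sigma_dot \<sigma> 0 y = 0" "sigma_dot \<sigma> x 0 = 0"
  by (simp_all add: sigma_dot_def)

lemma sigma_dot_axis [simp]:
  "sigma_dot \<sigma> x (axis i 1) = x $ i" "sigma_dot \<sigma> (axis i 1) x = \<sigma> (x $ i)"
proof -
  have "sigma_dot \<sigma> x (axis i 1) = (\<Sum>j\<in>UNIV. if j = i then x $ j else 0)"
    unfolding sigma_dot_def by (rule sum.cong) (auto simp: axis_def)
  then show "sigma_dot \<sigma> x (axis i 1) = x $ i" by simp
  have "sigma_dot \<sigma> (axis i 1) x = (\<Sum>j\<in>UNIV. if j = i then \<sigma> (x $ j) else 0)"
    unfolding sigma_dot_def by (rule sum.cong) (auto simp: axis_def)
  then show "sigma_dot \<sigma> (axis i 1) x = \<sigma> (x $ i)" by simp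
qed

lemma sigma_dot_eq_0D: "(\<And>y. sigma_dot \<sigma> x y = 0) \<Longrightarrow> x = 0"
  by (metis sigma_dot_axis(1) vec_eq_iff zero_index)

lemma sigma_dot_mult:
  "sigma_dot \<sigma> (x v* M) y = sigma_dot \<sigma> x (y v* conj_transpose \<sigma> M)"
proof -
  have "sigma_dot \<sigma> (x v* M) y = (\<Sum>j\<in>UNIV. \<Sum>i\<in>UNIV. x $ i * M $ i $ j * \<sigma> (y $ j))"
    by (simp add: sigma_dot_def vector_matrix_mult_def sum_distrib_right)
  also have "\<dots> = (\<Sum>i\<in>UNIV. \<Sum>j\<in>UNIV. x $ i * M $ i $ j * \<sigma> (y $ j))"
    by (rule sum.swap)
  also have "\<dots> = sigma_dot \<sigma> x (y v* conj_transpose \<sigma> M)"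
    by (simp add: sigma_dot_def vector_matrix_mult_def conj_transpose_def sigma_sum sigma_mult
        sum_distrib_left mult.assoc)
  finally show ?thesis .
qed

lemma hermitian_iff_conj_transpose: "M \<in> hermitian_matrices \<sigma> \<longleftrightarrow> conj_transpose \<sigma> M = M"
  by (simp only: hermitian_matrices_def mem_Collect_eq eq_commute[of M])

lemma sigma_dot_hermitian:
  "M \<in> hermitian_matrices \<sigma> \<Longrightarrow> sigma_dot \<sigma> (x v* M) y = sigma_dot \<sigma> x (y v* M)"
  by (simp add: sigma_dot_mult hermitian_iff_conj_transpose)

lemma hermitian_iff_sigma_dot:
  "M \<in> hermitian_matrices \<sigma> \<longleftrightarrow> (\<forall>x y. sigma_dot \<sigma> (x v* M) y = sigma_dot \<sigma> x (y v* M))"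
proof
  assume *: "\<forall>x y. sigma_dot \<sigma> (x v* M) y = sigma_dot \<sigma> x (y v* M)"
  have [simp]: "(axis i 1 v* M) $ j = M $ i $ j" for i j
    by (simp add: vector_matrix_mult_def axis_def if_distrib if_distribR cong: if_cong)
  have "conj_transpose \<sigma> M $ i $ j = M $ i $ j" for i j
    using *[rule_format, of "axis i 1" "axis j 1"] by (simp add: conj_transpose_def)
  then show "M \<in> hermitian_matrices \<sigma>"
    by (simp only: hermitian_iff_conj_transpose vec_eq_iff simp_thms)
qed (simp add: sigma_dot_hermitian)

lemma hermitian_uminus:
  "M \<in> hermitian_matrices \<sigma> \<Longrightarrow> - M \<in> hermitian_matrices \<sigma>"
  by (simp add: hermitian_iff_sigma_dot vector_mult_uminus sigma_dot_uminus)

lemma beta_form_add_left: "beta_form \<sigma> (x + x') y = beta_form \<sigma> x y + beta_form \<sigma> x' y"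
  by (simp add: beta_form_def sum.distrib[symmetric] algebra_simps)

lemma beta_form_scale_left: "beta_form \<sigma> (c *s x) y = c * beta_form \<sigma> x y"
  by (simp add: beta_form_def sum_distrib_left algebra_simps)

lemma sigma_beta_form: "\<sigma> (beta_form \<sigma> x y) = - beta_form \<sigma> y x"
  by (simp add: beta_form_def sigma_sum sigma_diff sigma_mult sum_negf[symmetric])

lemma beta_form_eq_0_commute: "beta_form \<sigma> x y = 0 \<longleftrightarrow> beta_form \<sigma> y x = 0"
  by (metis sigma_beta_form neg_equal_0_iff_equal sigma_eq_0_iff)

lemma beta_form_add_right: "beta_form \<sigma> x (y + y') = beta_form \<sigma> x y + beta_form \<sigma> x y'"
  by (simp add: beta_form_def sum.distrib[symmetric] sigma_add algebra_simps)

lemma beta_form_scale_right: "beta_form \<sigma> x (c *s y) = beta_form \<sigma> x y * \<sigma> c"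
  by (simp add: beta_form_def sum_distrib_right sigma_mult algebra_simps)

text \<open>
  Otherwise adjoining \<open>v\<close> to \<open>U\<close> would give a larger totally isotropic subspace. The hypothesis
  on \<open>v\<close> itself is a separate one: the form need not be alternating when \<open>\<sigma>\<close> is not the identity.
\<close>

lemma maximal_totally_isotropic_mem:
  assumes U: "maximal_totally_isotropic \<sigma> U"
    and v: "beta_form \<sigma> v v = 0" "\<And>u. u \<in> U \<Longrightarrow> beta_form \<sigma> u v = 0"
  shows "v \<in> U"
proof -
  have iso: "totally_isotropic \<sigma> U" using U by (simp add: maximal_totally_isotropic_def)
  note U' = totally_isotropicD[OF iso]
  have v': "beta_form \<sigma> v u = 0" if "u \<in> U" for u
    using v(2)[OF that] by (subst beta_form_eq_0_commute)
  let ?V = "{u + c *s v | u c. u \<in> U}"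
  have "left_subspace ?V"
    unfolding left_subspace_def
  proof (intro conjI ballI allI)
    show "0 \<in> ?V" using left_subspace_0[OF U'(1)] by (auto intro!: exI[of _ 0])
    fix x assume "x \<in> ?V"
    then obtain u c where x: "x = u + c *s v" "u \<in> U" by blast
    show "d *s x \<in> ?V" for d
      using x left_subspace_scale[OF U'(1), of u d]
      by (auto simp: vector_add_ldistrib)
    fix y assume "y \<in> ?V"
    then obtain u' c' where y: "y = u' + c' *s v" "u' \<in> U" by blast
    have "x + y = (u + u') + (c + c') *s v" by (simp add: x y vector_sadd_rdistrib)
    then show "x + y \<in> ?V" using x y left_subspace_add[OF U'(1)] by blast
  qed
  moreover have "\<forall>x\<in>?V. \<forall>y\<in>?V. beta_form \<sigma> x y = 0"
    using U'(2) v v' by (auto simp: beta_form_add_left beta_form_add_right beta_form_scale_left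
        beta_form_scale_right)
  ultimately have "totally_isotropic \<sigma> ?V" by (simp add: totally_isotropic_def)
  moreover have "U \<subseteq> ?V"
  proof
    fix u assume "u \<in> U"
    moreover have "u = u + 0 *s v" by simp
    ultimately show "u \<in> ?V" by blast
  qed
  ultimately have "?V = U" using U by (auto simp: maximal_totally_isotropic_def)
  moreover have "0 + 1 *s v \<in> ?V" using left_subspace_0[OF U'(1)] by blast
  ultimately show ?thesis by simp
qed

lemma beta_form_shear:
  "T \<in> hermitian_matrices \<sigma> \<Longrightarrow> beta_form \<sigma> (shear T u) (shear T v) = beta_form \<sigma> u v"
  by (cases u rule: join_cases; cases v rule: join_cases)
    (simp add: beta_form_join sigma_dot_add_left sigma_dot_add_right sigma_dot_hermitian)

lemma totally_isotropic_shear: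
  "T \<in> hermitian_matrices \<sigma> \<Longrightarrow> totally_isotropic \<sigma> U \<Longrightarrow> totally_isotropic \<sigma> (shear T ` U)"
  by (auto simp: totally_isotropic_def left_subspace_shear beta_form_shear)

text \<open>A shear by a Hermitian matrix is an isometry whose inverse, the shear by \<open>- T\<close>, is of the
  same kind, so it permutes the totally isotropic subspaces and respects inclusion.\<close>

lemma maximal_totally_isotropic_shear:
  assumes T: "T \<in> hermitian_matrices \<sigma>" and U: "maximal_totally_isotropic \<sigma> U"
  shows "maximal_totally_isotropic \<sigma> (shear T ` U)"
  unfolding maximal_totally_isotropic_def
proof (intro conjI allI impI)
  show "totally_isotropic \<sigma> (shear T ` U)"
    using T U by (simp add: totally_isotropic_shear maximal_totally_isotropic_def)
  fix V assume V: "totally_isotropic \<sigma> V \<and> shear T ` U \<subseteq> V"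
  then have "shear (- T) ` shear T ` U \<subseteq> shear (- T) ` V" by blast
  then have "U \<subseteq> shear (- T) ` V" by simp
  moreover have "totally_isotropic \<sigma> (shear (- T) ` V)"
    using V T by (simp add: totally_isotropic_shear hermitian_uminus)
  ultimately have "shear (- T) ` V = U" using U by (auto simp: maximal_totally_isotropic_def)
  then show "V = shear T ` U" by (metis shear_image_shear_uminus(1))
qed

text \<open>
  For maximality, a vector \<open>(x, y)\<close> of a larger totally isotropic subspace can be moved by a vector
  of the graph to some \<open>(0, w)\<close>, and orthogonality to the graph, whose first components are
  arbitrary, forces \<open>w = 0\<close>.
\<close>

lemma maximal_totally_isotropic_graph:
  fixes M :: "'a^'n^'n"
  assumes M: "M \<in> hermitian_matrices \<sigma>"
  shows "maximal_totally_isotropic \<sigma> (graph M)"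
  unfolding maximal_totally_isotropic_def
proof (intro conjI allI impI)
  have "left_subspace (graph M)"
    using left_subspace_range[of "augment (mat 1) M"] by (simp add: graph_def vector_mult_augment)
  then show "totally_isotropic \<sigma> (graph M)"
    using M by (auto simp: totally_isotropic_def graph_def beta_form_join sigma_dot_hermitian)
  fix V :: "('a^('n + 'n)) set" assume "totally_isotropic \<sigma> V \<and> graph M \<subseteq> V"
  then have V: "totally_isotropic \<sigma> V" and sub: "graph M \<subseteq> V" by auto
  have "v \<in> graph M" if "v \<in> V" for v
  proof (cases v rule: join_cases)
    case (1 x y)
    let ?w = "y - x v* M"
    have graph_V: "join z (z v* M) \<in> V" for z using sub by (auto simp: graph_def)
    have "join 0 ?w \<in> V"
      using left_subspace_diff[OF totally_isotropicD(1)[OF V] that graph_V[of x]] 1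
      by (simp add: join_diff)
    then have "beta_form \<sigma> (join 0 ?w) (join z (z v* M)) = 0" for z
      using totally_isotropicD(2)[OF V _ graph_V] by blast
    then have "sigma_dot \<sigma> ?w z = 0" for z by (simp add: beta_form_join)
    then have "?w = 0" by (rule sigma_dot_eq_0D)
    then show ?thesis using 1 by (simp add: graph_def)
  qed
  then show "V = graph M" using sub by blast
qed

section \<open>Sheared graphs exhaust the maximal totally isotropic subspaces\<close>

text \<open>
  A proper subspace \<open>P\<close> is annihilated by a nonzero vector: the projection \<open>g\<close> onto a complementary
  coordinate subspace, along \<open>P\<close>, is left linear, so each of its coordinates is given by a column
  of a matrix acting from the right. Applying \<open>\<sigma>\<close> to that column turns it into the second argument
  of the sesquilinear product.
\<close>

lemma subspace_eq_UNIV_if_no_annihilator: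
  fixes P :: "('a^'m) set"
  assumes P: "left_subspace P"
    and ann: "\<And>z. (\<And>x. x \<in> P \<Longrightarrow> sigma_dot \<sigma> x z = 0) \<Longrightarrow> z = 0"
  shows "P = UNIV"
proof -
  obtain J where J: "P \<inter> coordinate_subspace J = {0}"
    and compl: "\<And>x. \<exists>y \<in> coordinate_subspace J. x - y \<in> P"
    using coordinate_complement[OF P] by blast
  note E = left_subspace_coordinate_subspace[of J]
  obtain g where g: "\<And>x. g x \<in> coordinate_subspace J" "\<And>x. x - g x \<in> P"
    using compl by metis
  have g_unique: "g x = y" if "y \<in> coordinate_subspace J" "x - y \<in> P" for x y
  proof -
    have "(x - y) - (x - g x) \<in> P" using left_subspace_diff[OF P that(2) g(2)] .
    then have "g x - y \<in> P \<inter> coordinate_subspace J"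
      using left_subspace_diff[OF E g(1) that(1)] by simp
    then show ?thesis using J by simp
  qed
  have "g (x + y) = g x + g y" for x y
    using left_subspace_add[OF P g(2)[of x] g(2)[of y]]
    by (intro g_unique left_subspace_add[OF E] g) (simp add: algebra_simps)
  moreover have "g (c *s x) = c *s g x" for c x
    using left_subspace_scale[OF P g(2)[of x], of c]
    by (intro g_unique left_subspace_scale[OF E] g) (simp add: vector_ssub_ldistrib)
  ultimately obtain G where G: "\<And>x. g x = x v* G" by (rule left_linear_eq_matrix) blast
  have gP: "g x = 0" if "x \<in> P" for x
    using that by (intro g_unique left_subspace_0[OF E]) simp
  have "J = {}"
  proof (rule ccontr)
    assume "J \<noteq> {}"
    then obtain j where j: "j \<in> J" by blast
    let ?z = "\<chi> i. \<sigma> (G $ i $ j)"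
    have dot: "sigma_dot \<sigma> x ?z = g x $ j" for x
      by (simp add: sigma_dot_def G vector_matrix_mult_def)
    then have "?z = 0" using gP by (intro ann) simp
    moreover have "g (axis j 1) = axis j 1"
      using j left_subspace_0[OF P]
      by (intro g_unique) (auto simp: coordinate_subspace_def axis_def)
    ultimately show False using dot[of "axis j 1"] by simp
  qed
  have "x \<in> P" for x
  proof -
    have "g x = 0" using g(1)[of x] \<open>J = {}\<close> by (simp add: coordinate_subspace_def vec_eq_iff)
    then show ?thesis using g(2)[of x] by simp
  qed
  then show ?thesis by blast
qed

text \<open>
  The hypothesis \<open>triv\<close> makes \<open>U\<close> the graph of a partial left linear map, and maximality makes
  its domain everything, because a vector annihilating the domain yields a vector \<open>(0, z)\<close>
  isotropic and orthogonal to \<open>U\<close>. Isotropy of the graph says that the map is self-adjoint.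
\<close>

lemma maximal_totally_isotropic_eq_graph:
  fixes U :: "('a^('n::finite + 'n)) set"
  assumes U: "maximal_totally_isotropic \<sigma> U" and triv: "\<And>y. join 0 y \<in> U \<Longrightarrow> y = 0"
  obtains M where "M \<in> hermitian_matrices \<sigma>" and "U = graph M"
proof -
  have iso: "totally_isotropic \<sigma> U" using U by (simp add: maximal_totally_isotropic_def)
  note sub = totally_isotropicD(1)[OF iso]
  let ?P = "{x. \<exists>y. join x y \<in> U}"
  have "?P = UNIV"
  proof (rule subspace_eq_UNIV_if_no_annihilator)
    show "left_subspace ?P"
      unfolding left_subspace_def mem_Collect_eq
    proof (intro conjI allI ballI)
      show "\<exists>y. join 0 y \<in> U" using left_subspace_0[OF sub] by (metis join_0)
      fix x assume "x \<in> ?P"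
      then obtain y where y: "join x y \<in> U" by blast
      show "\<exists>y. join (c *s x) y \<in> U" for c
        using left_subspace_scale[OF sub y, of c] by (auto simp: join_scale)
      fix x' assume "x' \<in> ?P"
      then obtain y' where "join x' y' \<in> U" by blast
      then show "\<exists>y. join (x + x') y \<in> U"
        using left_subspace_add[OF sub y] by (fastforce simp: join_add)
    qed
    fix z assume z: "\<And>x. x \<in> ?P \<Longrightarrow> sigma_dot \<sigma> x z = 0"
    have "join 0 z \<in> U"
    proof (rule maximal_totally_isotropic_mem[OF U])
      show "beta_form \<sigma> (join 0 z) (join 0 z) = 0" by (simp add: beta_form_join)
      show "beta_form \<sigma> u (join 0 z) = 0" if "u \<in> U" for u
        using that z by (cases u rule: join_cases) (auto simp: beta_form_join)
    qed
    then show "z = 0" by (rule triv)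
  qed
  then have "\<exists>y. join x y \<in> U" for x by blast
  then obtain f where f: "\<And>x. join x (f x) \<in> U" by metis
  have f_unique: "f x = y" if "join x y \<in> U" for x y
  proof -
    have "join 0 (f x - y) \<in> U"
      using left_subspace_diff[OF sub f[of x] that] by (simp add: join_diff)
    then show ?thesis using triv by fastforce
  qed
  have "f (x + y) = f x + f y" for x y
    using left_subspace_add[OF sub f[of x] f[of y]] by (intro f_unique) (simp add: join_add)
  moreover have "f (c *s x) = c *s f x" for c x
    using left_subspace_scale[OF sub f[of x], of c] by (intro f_unique) (simp add: join_scale)
  ultimately obtain M where M: "\<And>x. f x = x v* M" by (rule left_linear_eq_matrix) blast
  have "u \<in> graph M" if "u \<in> U" for u
    using that f_unique by (cases u rule: join_cases) (auto simp: graph_def M)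
  then have "U = graph M" using f by (auto simp: graph_def M)
  moreover have "M \<in> hermitian_matrices \<sigma>"
    unfolding hermitian_iff_sigma_dot
  proof (intro allI)
    fix x y
    have "beta_form \<sigma> (join x (x v* M)) (join y (y v* M)) = 0"
      using totally_isotropicD(2)[OF iso f f] by (simp add: M)
    then show "sigma_dot \<sigma> (x v* M) y = sigma_dot \<sigma> x (y v* M)"
      by (simp add: beta_form_join)
  qed
  ultimately show ?thesis using that by blast
qed

text \<open>
  The vectors \<open>(yT, y)\<close> form the image of \<open>0 \<times> K\<^sup>n\<close> under the shear by \<open>T\<close>, so the conclusion says
  that the inverse shear moves \<open>U\<close> to a subspace meeting \<open>0 \<times> K\<^sup>n\<close> trivially. The diagonal
  matrix with entries \<open>0\<close> on \<open>J\<close> and \<open>1\<close> off \<open>J\<close> is Hermitian because \<open>\<sigma>\<close> fixes \<open>0\<close> and \<open>1\<close>.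
\<close>

lemma exists_transversal_hermitian:
  fixes U :: "('a^('n::finite + 'n)) set"
  assumes U: "totally_isotropic \<sigma> U"
  obtains T where "T \<in> hermitian_matrices \<sigma>" and "\<And>y. join (y v* T) y \<in> U \<Longrightarrow> y = 0"
proof -
  note sub = totally_isotropicD(1)[OF U]
  let ?P = "{y. join 0 y \<in> U}"
  have "left_subspace ?P"
    unfolding left_subspace_def mem_Collect_eq
  proof (intro conjI allI ballI)
    show "join 0 0 \<in> U" using left_subspace_0[OF sub] by (simp add: join_0)
    fix y assume y: "y \<in> ?P"
    show "join 0 (c *s y) \<in> U" for c
      using y left_subspace_scale[OF sub, of "join 0 y" c] by (simp add: join_scale)
    fix y' assume "y' \<in> ?P"
    then show "join 0 (y + y') \<in> U"
      using y left_subspace_add[OF sub, of "join 0 y" "join 0 y'"] by (simp add: join_add)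
  qed
  then obtain J where J: "?P \<inter> coordinate_subspace J = {0}"
    and compl: "\<And>x. \<exists>y \<in> coordinate_subspace J. x - y \<in> ?P"
    using coordinate_complement by blast
  let ?T = "(\<chi> i j. if i = j \<and> i \<notin> J then 1 else 0) :: 'a^'n^'n"
  have T_nth: "(y v* ?T) $ i = (if i \<in> J then 0 else y $ i)" for y i
  proof -
    have "(y v* ?T) $ i = (\<Sum>k\<in>UNIV. if k = i then (if i \<in> J then 0 else y $ i) else 0)"
      unfolding vector_matrix_mult_def vec_lambda_beta by (rule sum.cong) auto
    then show ?thesis by simp
  qed
  show ?thesis
  proof
    show "?T \<in> hermitian_matrices \<sigma>"
      by (auto simp: hermitian_matrices_def conj_transpose_def vec_eq_iff)
    fix y assume y: "join (y v* ?T) y \<in> U"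
    \<comment> \<open>A vector \<open>z\<close> splits into a part in \<open>P\<close>, orthogonal to \<open>yT\<close> by isotropy of \<open>U\<close>, and a part
        supported on \<open>J\<close>, where \<open>yT\<close> vanishes.\<close>
    have "y v* ?T = 0"
    proof (rule sigma_dot_eq_0D)
      fix z
      obtain w where w: "w \<in> coordinate_subspace J" "z - w \<in> ?P" using compl by blast
      have "beta_form \<sigma> (join (y v* ?T) y) (join 0 (z - w)) = 0"
        using totally_isotropicD(2)[OF U y] w(2) by blast
      then have "sigma_dot \<sigma> (y v* ?T) (z - w) = 0" by (simp add: beta_form_join)
      moreover have "sigma_dot \<sigma> (y v* ?T) w = 0"
        using w(1) unfolding sigma_dot_def
        by (intro sum.neutral) (auto simp: T_nth coordinate_subspace_def)
      ultimately show "sigma_dot \<sigma> (y v* ?T) z = 0"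
        using sigma_dot_add_right[of "y v* ?T" "z - w" w] by simp
    qed
    then have "y \<in> ?P" and "y \<in> coordinate_subspace J"
      using y T_nth[of y] by (auto simp: coordinate_subspace_def) (metis zero_index)
    then show "y = 0" using J by blast
  qed
qed

text \<open>
  Shearing \<open>(x, - xT\<^sub>2)\<close> by \<open>T\<^sub>1\<close> gives \<open>(x - xT\<^sub>2T\<^sub>1, - xT\<^sub>2)\<close>, which is \<open>-x\<close> times
  \<open>(T\<^sub>2T\<^sub>1 - I, T\<^sub>2)\<close>; this sign is the reason for the substitution \<open>x \<mapsto> -x\<close> in the proof.
\<close>

lemma hermitian_point_eq_shear_graph:
  fixes T\<^sub>1 T\<^sub>2 :: "'a^'n^'n"
  shows "left_row_space (augment (T\<^sub>2 ** T\<^sub>1 - mat 1) T\<^sub>2) = shear T\<^sub>1 ` graph (- T\<^sub>2)"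
proof -
  have "left_row_space (augment (T\<^sub>2 ** T\<^sub>1 - mat 1) T\<^sub>2) =
      range (\<lambda>x. join (x v* T\<^sub>2 v* T\<^sub>1 - x) (x v* T\<^sub>2))"
    by (simp add: left_row_space_eq_range vector_mult_augment vector_matrix_mult_diff_rdistrib
        vector_matrix_mul_assoc)
  also have "\<dots> = range (\<lambda>x. shear T\<^sub>1 (join (- x) (- x v* - T\<^sub>2)))"
    by (simp add: vector_mult_uminus vector_uminus_mult)
  also have "\<dots> = (\<lambda>x. shear T\<^sub>1 (join x (x v* - T\<^sub>2))) ` range uminus"
    by (simp only: image_image)
  also have "\<dots> = shear T\<^sub>1 ` graph (- T\<^sub>2)"
    by (simp add: graph_def image_image surj_uminus)
  finally show ?thesis .
qed

lemma maximal_totally_isotropic_iff: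
  fixes U :: "('a^('n::finite + 'n)) set"
  shows "maximal_totally_isotropic \<sigma> U \<longleftrightarrow>
    (\<exists>T\<^sub>1 \<in> hermitian_matrices \<sigma>. \<exists>T\<^sub>2 \<in> hermitian_matrices \<sigma>.
       U = left_row_space (augment (T\<^sub>2 ** T\<^sub>1 - mat 1) T\<^sub>2))"
proof
  assume U: "maximal_totally_isotropic \<sigma> U"
  then obtain T where T: "T \<in> hermitian_matrices \<sigma>"
    and triv: "\<And>y. join (y v* T) y \<in> U \<Longrightarrow> y = 0"
    using exists_transversal_hermitian[of U] by (auto simp: maximal_totally_isotropic_def)
  have "y = 0" if "join 0 y \<in> shear (- T) ` U" for y
  proof (rule triv)
    have "shear T (join 0 y) \<in> shear T ` shear (- T) ` U" using that by blast
    then show "join (y v* T) y \<in> U" by simp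
  qed
  moreover have "maximal_totally_isotropic \<sigma> (shear (- T) ` U)"
    using T U by (simp add: maximal_totally_isotropic_shear hermitian_uminus)
  ultimately obtain M where M: "M \<in> hermitian_matrices \<sigma>" "shear (- T) ` U = graph M"
    using maximal_totally_isotropic_eq_graph[of "shear (- T) ` U"] by metis
  then have "U = left_row_space (augment ((- M) ** T - mat 1) (- M))"
    using shear_image_shear_uminus(1)[of T U] by (simp add: hermitian_point_eq_shear_graph)
  then show "\<exists>T\<^sub>1 \<in> hermitian_matrices \<sigma>. \<exists>T\<^sub>2 \<in> hermitian_matrices \<sigma>.
       U = left_row_space (augment (T\<^sub>2 ** T\<^sub>1 - mat 1) T\<^sub>2)"
    using T hermitian_uminus[OF M(1)] by blast
qed (auto simp: hermitian_point_eq_shear_graph hermitian_uminus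
    maximal_totally_isotropic_shear maximal_totally_isotropic_graph)

end

theorem theorem1:
  fixes \<sigma> :: "'a::division_ring \<Rightarrow> 'a"
  assumes "involution \<sigma>" and "CARD('n::finite) \<ge> 2"
  shows "(proj_space_points \<sigma> :: ('a^('n + 'n)) set set) = point_subspace ` proj_line_hermitian \<sigma>
    \<and> {U :: ('a^('n + 'n)) set. maximal_totally_isotropic \<sigma> U} =
        {left_row_space (augment (T\<^sub>2 ** T\<^sub>1 - mat 1) T\<^sub>2) | T\<^sub>1 T\<^sub>2 :: 'a^'n^'n.
           T\<^sub>1 \<in> hermitian_matrices \<sigma> \<and> T\<^sub>2 \<in> hermitian_matrices \<sigma>}"
proof -
  interpret division_ring_involution \<sigma> by unfold_locales (rule assms(1))
  let ?L = "{left_row_space (augment (T\<^sub>2 ** T\<^sub>1 - mat 1) T\<^sub>2) | T\<^sub>1 T\<^sub>2 :: 'a^'n^'n.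
           T\<^sub>1 \<in> hermitian_matrices \<sigma> \<and> T\<^sub>2 \<in> hermitian_matrices \<sigma>}"
  have "{U. maximal_totally_isotropic \<sigma> U} = ?L"
    using maximal_totally_isotropic_iff by blast
  moreover have "point_subspace ` proj_line_hermitian \<sigma> = ?L"
    using point_subspace_cyclic_submodule[OF left_row_rank_hermitian_point]
    by (force simp: proj_line_hermitian_def)
  ultimately show ?thesis by (simp add: proj_space_points_def)
qed

end
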